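(* The pricing strategy $$p_{k,l,t}=v_{l,t}-v_{-k}\qquad (l\in\{1,\dots,L\},\ t\in\{t_k+1,\dots,T\}),$$ which does not depend on the utilities of the user, maximizes the ex-post social welfare: for every possible realization $(u_{k,l,t})_{l,t}$ of the random utilities $(U_{k,l,t})_{l,t}$, it maximizes $$\sum_{l=1}^{L}\sum_{t=t_k+1}^{T}(u_{k,l,t}-v_{l,t}+v_{-k})\,A_{k,l,t}(\mathbf{p}_k)$$ over all price menus $\mathbf p_k=(p_{k,l,t})_{l,t}$ with $p_{k,l,t}\ge 0$.
   Context: Contracts and user. User $k$ arrives at a charging station at time $t_k<T$ (discrete time, horizon $T$). A contract is a pair $(l,t)$ with energy level $l\in\{1,\dots,L\}$ and deadline $t\in\{t_k+1,\dots,T\}$. The station posts a price $p_{k,l,t}\ge 0$ for every contract; $\mathbf p_k=(p_{k,l,t})_{l,t}$ (the value $+\infty$ is allowed; a contract with infinite price is never accepted, and its terms in all sums are read as $0$). User $k$ has real utility $u_{k,l,t}$ for contract $(l,t)$, the realization of a random variable $U_{k,l,t}$ (the $U_{k,l,t}$ have some joint distribution, not necessarily independent), and utility $0$ if it rejects all contracts. The user knows its realized utilities; the station does not. Given $\mathbf p_k$ the user is a price taker and chooses $A_{k,l,t}(\mathbf p_k)\in[0,1]$ to maximize $\sum_{l,t}A_{k,l,t}(u_{k,l,t}-p_{k,l,t})$ subject to $\sum_{l,t}A_{k,l,t}\le 1$: it chooses a contract (or any convex combination of contracts) attaining the maximal payoff $\max_{i,j}(u_{k,i,j}-p_{k,i,j})$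 if this maximum is $\ge 0$ (ties between charging and not charging are resolved in favour of charging, so then $\sum_{l,t} A_{k,l,t}=1$), and all $A_{k,l,t}=0$ if the maximum is negative. Costs. $\mathcal K_0$ is the set of users already present at time $t_k$; user $i\in\mathcal K_0$ has deadline $w_i$ and remaining demand $N_i$. Known data: conventional energy prices $c_t\ge0$, harvested energies $\bar E^t\ge 0$, maximal charging rate $R_{max}$, battery capacity $B_{max}$, initial battery level $B_0\in[0,B_{max}]$. For a contract $(l,d)$, $v_{l,d}$ is the optimal value of the linear program: minimize $\sum_{t=t_k}^{T-1}c_tq_t$ over nonnegative variables $r_{k,t},q_{k,t},r_{i,t},q_{i,t}\ (i\in\mathcal K_0),\,q_t,r_t,D_t$ (for $t_k\le t\le T-1$) and battery levels $B^t$, subject to (a) $\sum_{t=t_k}^{d-1}(r_{k,t}+q_{k,t})\ge l$; (b) $\sum_{t=t_k}^{w_i-1}(r_{i,t}+q_{i,t})\ge N_i$ for all $i\in\mathcal K_0$; (c) $r_{k,t}+q_{k,t}\le R_{max}$ and $r_{i,t}+q_{i,t}\le R_{max}$ for all $i\in\mathcal K_0$ and all $t$; (d) $r_{k,t}+\sum_{i\in\mathcal K_0}r_{i,t}=r_t$ and $q_{k,t}+\sum_{i\in\mathcal K_0}q_{i,t}\le q_t$ for all $t$; (e) $B^{t+1}=B^t+\bar E^t-r_t+q_t-q_{k,t}-\sum_{i\in\mathcal K_0}q_{i,t}-D_t$, $0\le B^{t+1}\le B_{max}$, $B^{t_k}=B_0$, $B^T=B_0$. If the program is infeasible, $v_{l,d}=\infty$.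 $v_{-k}$ is the optimal value of the same program with $r_{k,t}=q_{k,t}=0$ for all $t$ and constraint (a) dropped (the cost of serving only the existing users), assumed finite. These costs do not depend on the prices, and $v_{l,t}-v_{-k}\ge 0$. Social welfare is the sum of the user surplus and the station's profit, i.e. $\sum_{l,t}(u_{k,l,t}-v_{l,t}+v_{-k})A_{k,l,t}(\mathbf p_k)$. *)

theory Defs
  imports "HOL-Probability.Probability"
begin

text \<open>
  Data known to the station when the new user arrives. The new user \<open>k\<close> is not an element of
  \<open>present\<close>; its variables are kept apart from those of the existing users.
\<close>

record 'i station =
  arrival :: nat                      (* t_k *)
  horizon :: nat                      (* T *)
  max_level :: nat                    (* L *)
  present :: "'i set"                 (* K_0 *)
  departure :: "'i \<Rightarrow> nat"            (* w_i *)
  demand :: "'i \<Rightarrow> real"              (* N_i *)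
  energy_price :: "nat \<Rightarrow> real"       (* c_t *)
  harvest :: "nat \<Rightarrow> real"            (* E^t *)
  rate_max :: real                    (* R_max *)
  battery_max :: real                 (* B_max *)
  battery_init :: real                (* B_0 *)

definition slots :: "'i station \<Rightarrow> nat set" where
  "slots S = {arrival S..<horizon S}"

definition well_formed :: "'i station \<Rightarrow> bool" where
  "well_formed S \<longleftrightarrow>
     arrival S < horizon S \<and> 1 \<le> max_level S \<and> finite (present S) \<and>
     (\<forall>i\<in>present S. departure S i \<le> horizon S) \<and>
     (\<forall>t\<in>slots S. 0 \<le> energy_price S t \<and> 0 \<le> harvest S t) \<and>
     0 \<le> battery_init S \<and> battery_init S \<le> battery_max S"

text \<open>
  Variables of the linear programs: \<open>r\<close> denotes harvested and \<open>q\<close> conventional energy; only their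
  values on the time slots (and those of \<open>battery\<close> up to the horizon) matter.
\<close>

record 'i schedule =
  r_new :: "nat \<Rightarrow> real"              (* r_{k,t} *)
  q_new :: "nat \<Rightarrow> real"              (* q_{k,t} *)
  r_old :: "'i \<Rightarrow> nat \<Rightarrow> real"        (* r_{i,t} *)
  q_old :: "'i \<Rightarrow> nat \<Rightarrow> real"        (* q_{i,t} *)
  r_total :: "nat \<Rightarrow> real"            (* r_t *)
  q_total :: "nat \<Rightarrow> real"            (* q_t *)
  discard :: "nat \<Rightarrow> real"            (* D_t *)
  battery :: "nat \<Rightarrow> real"            (* B^t *)

definition common_constraints :: "'i station \<Rightarrow> 'i schedule \<Rightarrow> bool" where
  "common_constraints S x \<longleftrightarrow>
     (\<forall>t\<in>slots S.
        0 \<le> r_new x t \<and> 0 \<le> q_new x t \<and> 0 \<le> q_total x t \<and> 0 \<le> r_total x t \<and> 0 \<le> discard x t \<and>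
        (\<forall>i\<in>present S. 0 \<le> r_old x i t \<and> 0 \<le> q_old x i t)) \<and>
     (\<forall>i\<in>present S.
        demand S i \<le> (\<Sum>t\<in>{arrival S..<departure S i}. r_old x i t + q_old x i t)) \<and>
     (\<forall>t\<in>slots S.
        r_new x t + q_new x t \<le> rate_max S \<and>
        (\<forall>i\<in>present S. r_old x i t + q_old x i t \<le> rate_max S)) \<and>
     (\<forall>t\<in>slots S.
        r_new x t + (\<Sum>i\<in>present S. r_old x i t) = r_total x t \<and>
        q_new x t + (\<Sum>i\<in>present S. q_old x i t) \<le> q_total x t) \<and>
     (\<forall>t\<in>slots S.
        battery x (t + 1) = battery x t + harvest S t - r_total x t + q_total x t
          - q_new x t - (\<Sum>i\<in>present S. q_old x i t) - discard x t \<and>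
        0 \<le> battery x (t + 1) \<and> battery x (t + 1) \<le> battery_max S) \<and>
     battery x (arrival S) = battery_init S \<and> battery x (horizon S) = battery_init S"

definition schedules_with :: "'i station \<Rightarrow> nat \<Rightarrow> nat \<Rightarrow> 'i schedule set" where
  "schedules_with S l d =
     {x. common_constraints S x \<and> real l \<le> (\<Sum>t\<in>{arrival S..<d}. r_new x t + q_new x t)}"

definition schedules_without :: "'i station \<Rightarrow> 'i schedule set" where
  "schedules_without S =
     {x. common_constraints S x \<and> (\<forall>t\<in>slots S. r_new x t = 0 \<and> q_new x t = 0)}"

definition energy_cost :: "'i station \<Rightarrow> 'i schedule \<Rightarrow> real" where
  "energy_cost S x = (\<Sum>t\<in>slots S. energy_price S t * q_total x t)"

text \<open>
  The optimal values \<open>v\<^sub>l\<^sub>,\<^sub>d\<close> and \<open>v\<^sub>-\<^sub>k\<close>. In \<^typ>\<open>ereal\<close> the infimum over an infeasible program is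
  \<open>\<infinity>\<close>.
\<close>

definition contract_cost :: "'i station \<Rightarrow> nat \<Rightarrow> nat \<Rightarrow> ereal" where
  "contract_cost S l d = (INF x\<in>schedules_with S l d. ereal (energy_cost S x))"

definition base_cost :: "'i station \<Rightarrow> ereal" where
  "base_cost S = (INF x\<in>schedules_without S. ereal (energy_cost S x))"

definition contracts :: "'i station \<Rightarrow> (nat \<times> nat) set" where
  "contracts S = {1..max_level S} \<times> {arrival S + 1..horizon S}"

definition price_menus :: "'i station \<Rightarrow> (nat \<Rightarrow> nat \<Rightarrow> ereal) set" where
  "price_menus S = {p. \<forall>(l, t)\<in>contracts S. 0 \<le> p l t}"

definition allocations :: "'i station \<Rightarrow> (nat \<Rightarrow> nat \<Rightarrow> real) set" where
  "allocations S =
     {a. (\<forall>(l, t)\<in>contracts S. a l t \<in> {0..1}) \<and> (\<Sum>(l, t)\<in>contracts S. a l t) \<le> 1}"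

text \<open>
  Since \<open>\<infinity> * 0 = 0\<close> in \<^typ>\<open>ereal\<close>, a contract with infinite price contributes \<open>0\<close> to the surplus
  when it is not accepted; accepting it with positive weight yields \<open>-\<infinity>\<close>, which is worse than
  rejecting all contracts.
\<close>

definition user_surplus ::
  "'i station \<Rightarrow> (nat \<Rightarrow> nat \<Rightarrow> real) \<Rightarrow> (nat \<Rightarrow> nat \<Rightarrow> ereal) \<Rightarrow> (nat \<Rightarrow> nat \<Rightarrow> real) \<Rightarrow> ereal" where
  "user_surplus S u p a = (\<Sum>(l, t)\<in>contracts S. ereal (a l t) * (ereal (u l t) - p l t))"

definition best_payoff ::
  "'i station \<Rightarrow> (nat \<Rightarrow> nat \<Rightarrow> real) \<Rightarrow> (nat \<Rightarrow> nat \<Rightarrow> ereal) \<Rightarrow> ereal" where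
  "best_payoff S u p = Max ((\<lambda>(l, t). ereal (u l t) - p l t) ` contracts S)"

definition user_choice ::
  "'i station \<Rightarrow> (nat \<Rightarrow> nat \<Rightarrow> real) \<Rightarrow> (nat \<Rightarrow> nat \<Rightarrow> ereal) \<Rightarrow> (nat \<Rightarrow> nat \<Rightarrow> real) \<Rightarrow> bool" where
  "user_choice S u p a \<longleftrightarrow>
     is_arg_max (user_surplus S u p) (\<lambda>b. b \<in> allocations S) a \<and>
     (if 0 \<le> best_payoff S u p
      then (\<Sum>(l, t)\<in>contracts S. a l t) = 1
      else \<forall>(l, t)\<in>contracts S. a l t = 0)"

text \<open>
  The choice need not be unique: \<open>A\<close> is any way in which a user with utilities \<open>u\<close> may react to
  the price menus.
\<close>

definition user_response ::
  "'i station \<Rightarrow> (nat \<Rightarrow> nat \<Rightarrow> real) \<Rightarrow> ((nat \<Rightarrow> nat \<Rightarrow> ereal) \<Rightarrow> nat \<Rightarrow> nat \<Rightarrow> real) \<Rightarrow> bool" where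
  "user_response S u A \<longleftrightarrow> (\<forall>p\<in>price_menus S. user_choice S u p (A p))"

text \<open>
  Serving a contract that is infeasible for the station has welfare \<open>-\<infinity>\<close>; such a contract
  contributes \<open>0\<close> when it is not accepted.
\<close>

definition social_welfare ::
  "'i station \<Rightarrow> (nat \<Rightarrow> nat \<Rightarrow> real) \<Rightarrow> (nat \<Rightarrow> nat \<Rightarrow> real) \<Rightarrow> ereal" where
  "social_welfare S u a =
     (\<Sum>l = 1..max_level S. \<Sum>t = arrival S + 1..horizon S.
        (ereal (u l t) - contract_cost S l t + base_cost S) * ereal (a l t))"

definition marginal_cost_prices :: "'i station \<Rightarrow> nat \<Rightarrow> nat \<Rightarrow> ereal" where
  "marginal_cost_prices S l t = contract_cost S l t - base_cost S"

end

theory Submission imports Defs begin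

text \<open>
  At the prices \<open>v\<^sub>l\<^sub>,\<^sub>t - v\<^sub>-\<^sub>k\<close> the station passes on exactly the cost that the new user causes, so the
  surplus of the user from an allocation is the social welfare of that allocation
  (\<open>user_surplus_at_marginal_cost\<close>). The user, who maximizes its surplus over all allocations, then
  maximizes social welfare over all allocations; any other price menu merely induces another one of
  them. This is a pointwise argument in the realized utilities.

  The prices must also form an admissible menu, i.e. be nonnegative: serving one more user
  cannot make the optimal schedule cheaper, since a schedule that serves the new user becomes one
  that does not if the energy of that user is no longer bought, or is discarded if it was harvested
  (\<open>base_cost_le_contract_cost\<close>).
\<close>

text \<open>
  The harvested energy of the new user is discarded instead, which keeps the battery levels
  unchanged; its conventional energy is not bought, which can only lower the cost.
\<close>

lemma schedule_without_new_user:
  assumes prices: "\<And>t. t \<in> slots S \<Longrightarrow> 0 \<le> energy_price S t"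
    and x: "common_constraints S x"
  obtains y where "y \<in> schedules_without S" "energy_cost S y \<le> energy_cost S x"
proof
  let ?y = "x\<lparr>r_new := \<lambda>_. 0, q_new := \<lambda>_. 0,
              r_total := \<lambda>t. r_total x t - r_new x t, q_total := \<lambda>t. q_total x t - q_new x t,
              discard := \<lambda>t. discard x t + r_new x t\<rparr>"
  have old_nonneg: "0 \<le> (\<Sum>i\<in>present S. r_old x i t)" "0 \<le> (\<Sum>i\<in>present S. q_old x i t)"
    if "t \<in> slots S" for t
    using x that by (auto simp: common_constraints_def intro!: sum_nonneg)
  have "0 \<le> rate_max S" "q_new x t \<le> q_total x t" "r_new x t \<le> r_total x t"
      "0 \<le> discard x t + r_new x t"
      "(\<Sum>i\<in>present S. r_old x i t) = r_total x t - r_new x t"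
      "(\<Sum>i\<in>present S. q_old x i t) \<le> q_total x t - q_new x t"
      "battery x (t + 1) = battery x t + harvest S t - (r_total x t - r_new x t) +
        (q_total x t - q_new x t) - (\<Sum>i\<in>present S. q_old x i t) - (discard x t + r_new x t)"
    if t: "t \<in> slots S" for t
  proof -
    have c: "r_new x t + (\<Sum>i\<in>present S. r_old x i t) = r_total x t"
      "q_new x t + (\<Sum>i\<in>present S. q_old x i t) \<le> q_total x t"
      "0 \<le> r_new x t" "0 \<le> q_new x t" "0 \<le> discard x t" "r_new x t + q_new x t \<le> rate_max S"
      "battery x (t + 1) = battery x t + harvest S t - r_total x t + q_total x t
          - q_new x t - (\<Sum>i\<in>present S. q_old x i t) - discard x t"
      using x t unfolding common_constraints_def by blast+
    show "0 \<le> rate_max S" "q_new x t \<le> q_total x t" "r_new x t \<le> r_total x t"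
      "0 \<le> discard x t + r_new x t"
      "(\<Sum>i\<in>present S. r_old x i t) = r_total x t - r_new x t"
      "(\<Sum>i\<in>present S. q_old x i t) \<le> q_total x t - q_new x t"
      "battery x (t + 1) = battery x t + harvest S t - (r_total x t - r_new x t) +
        (q_total x t - q_new x t) - (\<Sum>i\<in>present S. q_old x i t) - (discard x t + r_new x t)"
      using c old_nonneg[OF t] by linarith+
  qed
  then have "common_constraints S ?y"
    using x unfolding common_constraints_def by simp
  then show "?y \<in> schedules_without S"
    by (simp add: schedules_without_def)
  show "energy_cost S ?y \<le> energy_cost S x"
    using x prices by (auto simp: energy_cost_def common_constraints_def intro!: sum_mono mult_left_mono)
qed

lemma base_cost_le_contract_cost:
  assumes "well_formed S"
  shows "base_cost S \<le> contract_cost S l d"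
  unfolding contract_cost_def
proof (rule INF_greatest)
  fix x assume "x \<in> schedules_with S l d"
  then obtain y where "y \<in> schedules_without S" "energy_cost S y \<le> energy_cost S x"
    using schedule_without_new_user[of S x] assms
    by (auto simp: schedules_with_def well_formed_def)
  then show "base_cost S \<le> ereal (energy_cost S x)"
    unfolding base_cost_def by (intro INF_lower2[of y]) auto
qed

lemma marginal_cost_prices_in_price_menus:
  assumes "well_formed S" and "\<bar>base_cost S\<bar> \<noteq> \<infinity>"
  shows "marginal_cost_prices S \<in> price_menus S"
  using assms base_cost_le_contract_cost[OF assms(1)]
  by (auto simp: price_menus_def marginal_cost_prices_def ereal_diff_positive)

text \<open>
  The profit of the station vanishes at marginal cost prices. For a contract that the station cannot
  serve, price and cost are both \<open>\<infinity>\<close>, so its terms in welfare and surplus are \<open>-\<infinity>\<close> or \<open>0\<close>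
  together.
\<close>

lemma user_surplus_at_marginal_cost:
  assumes "\<bar>base_cost S\<bar> \<noteq> \<infinity>"
  shows "user_surplus S u (marginal_cost_prices S) a = social_welfare S u a"
proof -
  obtain b where b: "base_cost S = ereal b"
    using assms by auto
  have "ereal (u l t) - marginal_cost_prices S l t = ereal (u l t) - contract_cost S l t + base_cost S"
    for l t
    unfolding marginal_cost_prices_def b by (cases "contract_cost S l t") auto
  then show ?thesis
    by (simp add: user_surplus_def social_welfare_def contracts_def sum.cartesian_product
        mult.commute)
qed

theorem corollary1:
  fixes S :: "'i station" and M :: "'w measure" and U :: "nat \<Rightarrow> nat \<Rightarrow> 'w \<Rightarrow> real"
  assumes "well_formed S"
    and "\<bar>base_cost S\<bar> \<noteq> \<infinity>"
    and "prob_space M"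
    and "\<And>l t. (l, t) \<in> contracts S \<Longrightarrow> U l t \<in> borel_measurable M"
  shows "\<forall>\<omega>\<in>space M. \<forall>A. user_response S (\<lambda>l t. U l t \<omega>) A \<longrightarrow>
           is_arg_max (\<lambda>p. social_welfare S (\<lambda>l t. U l t \<omega>) (A p)) (\<lambda>p. p \<in> price_menus S)
             (marginal_cost_prices S)"
proof (intro ballI allI impI)
  fix \<omega> A
  let ?u = "\<lambda>l t. U l t \<omega>" and ?p = "marginal_cost_prices S"
  assume response: "user_response S ?u A"
  have menu: "?p \<in> price_menus S"
    using assms(1,2) by (rule marginal_cost_prices_in_price_menus)
  have choice: "user_choice S ?u p (A p)" if "p \<in> price_menus S" for p
    using response that by (simp add: user_response_def)
  have "is_arg_max (social_welfare S ?u) (\<lambda>b. b \<in> allocations S) (A ?p)"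
    using choice[OF menu] user_surplus_at_marginal_cost[OF assms(2)]
    by (simp add: user_choice_def is_arg_max_def)
  moreover have "A p \<in> allocations S" if "p \<in> price_menus S" for p
    using choice[OF that] by (simp add: user_choice_def is_arg_max_def)
  ultimately show "is_arg_max (\<lambda>p. social_welfare S ?u (A p)) (\<lambda>p. p \<in> price_menus S) ?p"
    using menu by (auto simp: is_arg_max_def)
qed

end
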